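(* The equality $$\log(\tan x) = -\frac{4}{\pi}\sum_{n=1}^\infty \frac{h_n}{n}\sin(4nx)$$ holds in $L^2([0,\pi/2])$ and, for any $f\in H_{\mathrm{odd}}$, we have $$L(f) = -\sum_{n=1}^\infty b_n(f)\,\frac{h_n}{n},$$ where $b_n(f) := \langle f,\sin(4n\,\cdot)\rangle = \frac{4}{\pi}\int_0^{\pi/2} f(x)\sin(4nx)\,\mathrm{d}x$.
   Context: For a positive integer $n$, $h_n := \sum_{k=1}^n \frac{1}{2k-1}$. The real Hilbert space $L^2([0,\pi/2])$ is equipped with the inner product $\langle f,g\rangle = \frac{4}{\pi}\int_0^{\pi/2} f(x)g(x)\,\mathrm{d}x$. The subspace $H_{\mathrm{odd}}$ is $$H_{\mathrm{odd}} := \left\{ f\in L^2([0,\pi/2]) : f\left(\tfrac{\pi}{2}-x\right) = -f(x)\ \text{almost everywhere}\right\}.$$ For $f\in L^2([0,\pi/2])$, $L(f) := \int_0^{\pi/2} f(x)\log(\tan x)\,\mathrm{d}x$. *)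

theory Defs
  imports "HOL-Analysis.Analysis"
begin

text \<open>
  Elements of the real Hilbert space $L^2([0,\pi/2])$ are represented by functions
  \<open>real \<Rightarrow> real\<close>; only their values on \<open>{0..pi/2}\<close>, up to null sets, matter below.
\<close>

abbreviation Leb :: "real measure" where
  "Leb \<equiv> lebesgue_on {0..pi/2}"

definition L2 :: "(real \<Rightarrow> real) set" where
  "L2 = {f. f \<in> borel_measurable Leb \<and> integrable Leb (\<lambda>x. (f x)\<^sup>2)}"

definition L2_inner :: "(real \<Rightarrow> real) \<Rightarrow> (real \<Rightarrow> real) \<Rightarrow> real" where
  "L2_inner f g = 4 / pi * (\<integral>x. f x * g x \<partial>Leb)"

definition L2_norm :: "(real \<Rightarrow> real) \<Rightarrow> real" where
  "L2_norm f = sqrt (L2_inner f f)"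

text \<open>The Bochner integrals in \<open>L2_inner\<close> (and hence in \<open>L\<close> below) exist on \<open>L2\<close>.\<close>

lemma L2_mult_integrable:
  assumes "f \<in> L2" "g \<in> L2"
  shows "integrable Leb (\<lambda>x. f x * g x)"
proof (rule Bochner_Integration.integrable_bound)
  show "integrable Leb (\<lambda>x. (f x)\<^sup>2 + (g x)\<^sup>2)"
    using assms by (simp add: L2_def)
  show "(\<lambda>x. f x * g x) \<in> borel_measurable Leb"
    using assms by (intro borel_measurable_times) (auto simp: L2_def)
  show "AE x in Leb. norm (f x * g x) \<le> norm ((f x)\<^sup>2 + (g x)\<^sup>2)"
  proof (rule AE_I2)
    fix x
    have "2 * (\<bar>f x\<bar> * \<bar>g x\<bar>) \<le> (f x)\<^sup>2 + (g x)\<^sup>2"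
      using sum_squares_bound[of "\<bar>f x\<bar>" "\<bar>g x\<bar>"] by simp
    moreover have "0 \<le> \<bar>f x\<bar> * \<bar>g x\<bar>" by simp
    ultimately have "\<bar>f x\<bar> * \<bar>g x\<bar> \<le> (f x)\<^sup>2 + (g x)\<^sup>2" by linarith
    then show "norm (f x * g x) \<le> norm ((f x)\<^sup>2 + (g x)\<^sup>2)"
      by (simp add: abs_mult)
  qed
qed

text \<open>The equality $g = \sum_{n \ge 0} F_n$ in $L^2([0,\pi/2])$: norm convergence of the partial sums.\<close>

definition L2_sums :: "(nat \<Rightarrow> real \<Rightarrow> real) \<Rightarrow> (real \<Rightarrow> real) \<Rightarrow> bool" where
  "L2_sums F g \<longleftrightarrow> (\<forall>n. F n \<in> L2) \<and> g \<in> L2 \<and>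
     (\<lambda>N. L2_norm (\<lambda>x. g x - (\<Sum>n<N. F n x))) \<longlonglongrightarrow> 0"

definition H_odd :: "(real \<Rightarrow> real) set" where
  "H_odd = {f \<in> L2. AE x in Leb. f (pi/2 - x) = - f x}"

text \<open>At the endpoints, where $\log(\tan x)$ is undefined, \<open>ln (tan x)\<close> takes a junk value;
  this only concerns a null set.\<close>

definition L :: "(real \<Rightarrow> real) \<Rightarrow> real" where
  "L f = (\<integral>x. f x * ln (tan x) \<partial>Leb)"

definition h :: "nat \<Rightarrow> real" where
  "h n = (\<Sum>k=1..n. 1 / (2 * real k - 1))"

definition b :: "nat \<Rightarrow> (real \<Rightarrow> real) \<Rightarrow> real" where
  "b n f = L2_inner f (\<lambda>x. sin (4 * real n * x))"

end

theory Submission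
  imports Defs "HOL-Real_Asymp.Real_Asymp"
begin

text \<open>
  With respect to the given inner product the functions \<open>sin (4 n x)\<close>, \<open>n \<ge> 1\<close>, are
  orthonormal, and the series is the Fourier series of \<open>ln (tan x)\<close> in this system. Two things
  are needed: the coefficients, and the fact that \<open>ln (tan x)\<close> lies in the closed span of
  the system.

  The coefficients come from one integration by parts, with \<open>sin\<^sup>2 (2 n x) / (2 n)\<close> as
  primitive of \<open>sin (4 n x)\<close>. Since the derivative of \<open>ln (tan x)\<close> is \<open>2 / sin (2 x)\<close>,
  what remains is the integral of \<open>sin\<^sup>2 (2 n x) / sin (2 x)\<close>, which is the sum of the
  \<open>sin (2 (2 k - 1) x)\<close> for \<open>1 \<le> k \<le> n\<close> (\<open>sin_power2_eq_sum\<close>); integrating termwise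
  gives \<open>h n\<close> (\<open>integral_ln_tan_sin\<close>).

  For the closed span, damp the endpoint singularities: multiply \<open>ln (tan x)\<close> by
  \<open>s\<^sup>2 / (s\<^sup>2 + \<epsilon>)\<close> with \<open>s = sin (4 x)\<close>. By dominated convergence this changes the function
  little in norm. The damped function is \<open>s\<close> times a continuous function that is symmetric
  about \<open>pi/4\<close>, hence \<open>s\<close> times a continuous function of \<open>cos (4 x)\<close>. Replacing the latter
  by a Weierstrass polynomial produces a finite combination of the \<open>sin (4 n x)\<close>
  (\<open>ln_tan_approx_sine_polys\<close>). A Fourier partial sum is at least as close as any such
  combination that it is long enough to contain, so the partial sums converge.

  The formula for \<open>L f\<close> then follows by pairing the series with \<open>f\<close>, which is continuous in
  the norm by the Cauchy-Schwarz inequality.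
\<close>

section \<open>The inner product on square-integrable functions\<close>

lemma L2_add:
  assumes "f \<in> L2" "g \<in> L2"
  shows "(\<lambda>x. f x + g x) \<in> L2"
proof -
  have "integrable Leb (\<lambda>x. (f x)\<^sup>2 + 2 * (f x * g x) + (g x)\<^sup>2)"
    using assms L2_mult_integrable[OF assms] by (auto simp: L2_def)
  then show ?thesis
    using assms by (auto simp: L2_def power2_sum algebra_simps)
qed

lemma L2_scale:
  assumes "f \<in> L2"
  shows "(\<lambda>x. c * f x) \<in> L2"
  using assms by (auto simp: L2_def power_mult_distrib)

lemma L2_diff:
  assumes "f \<in> L2" "g \<in> L2"
  shows "(\<lambda>x. f x - g x) \<in> L2"
  using L2_add[OF assms(1) L2_scale[OF assms(2), of "-1"]] by simp

lemma L2_continuous: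
  fixes f :: "real \<Rightarrow> real"
  assumes "continuous_on {0..pi/2} f"
  shows "f \<in> L2"
proof -
  have "integrable Leb (\<lambda>x. (f x)\<^sup>2)"
    by (intro continuous_imp_integrable_real continuous_intros assms)
  moreover have "f \<in> borel_measurable Leb"
    by (rule continuous_imp_measurable_on_sets_lebesgue[OF assms]) simp
  ultimately show ?thesis by (simp add: L2_def)
qed

lemma L2_sum:
  fixes N :: nat
  assumes "\<And>n. n < N \<Longrightarrow> F n \<in> L2"
  shows "(\<lambda>x. \<Sum>n<N. F n x) \<in> L2"
  using assms
proof (induction N)
  case 0
  show ?case using L2_continuous[of "\<lambda>x. 0"] by simp
next
  case (Suc N)
  then show ?case using L2_add[of "\<lambda>x. \<Sum>n<N. F n x" "F N"] by simp
qed

lemma L2_inner_commute: "L2_inner f g = L2_inner g f"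
  by (simp add: L2_inner_def mult.commute)

lemma L2_inner_add_left:
  assumes "f \<in> L2" "g \<in> L2" "k \<in> L2"
  shows "L2_inner (\<lambda>x. f x + g x) k = L2_inner f k + L2_inner g k"
  using L2_mult_integrable[OF assms(1,3)] L2_mult_integrable[OF assms(2,3)]
  by (simp add: L2_inner_def distrib_right distrib_left)

lemma L2_inner_scale_left: "L2_inner (\<lambda>x. c * f x) k = c * L2_inner f k"
  by (simp add: L2_inner_def mult.assoc)

lemma L2_inner_diff_left:
  assumes "f \<in> L2" "g \<in> L2" "k \<in> L2"
  shows "L2_inner (\<lambda>x. f x - g x) k = L2_inner f k - L2_inner g k"
  using L2_mult_integrable[OF assms(1,3)] L2_mult_integrable[OF assms(2,3)]
  by (simp add: L2_inner_def left_diff_distrib right_diff_distrib)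

lemma L2_inner_sum_left:
  fixes N :: nat
  assumes "\<And>n. n < N \<Longrightarrow> F n \<in> L2" "k \<in> L2"
  shows "L2_inner (\<lambda>x. \<Sum>n<N. F n x) k = (\<Sum>n<N. L2_inner (F n) k)"
  using assms(1)
proof (induction N)
  case 0
  show ?case by (simp add: L2_inner_def)
next
  case (Suc N)
  then show ?case
    using L2_inner_add_left[OF L2_sum[of N F] _ assms(2), of "F N"] by simp
qed

lemma L2_inner_self_nonneg: "0 \<le> L2_inner f f"
  unfolding L2_inner_def by (intro mult_nonneg_nonneg integral_nonneg_AE) auto

lemma L2_norm_power2: "(L2_norm f)\<^sup>2 = L2_inner f f"
  by (simp add: L2_norm_def L2_inner_self_nonneg)

lemma L2_norm_nonneg: "0 \<le> L2_norm f"
  by (simp add: L2_norm_def L2_inner_self_nonneg)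

lemma L2_inner_self_diff:
  assumes "f \<in> L2" "g \<in> L2"
  shows "L2_inner (\<lambda>x. f x - g x) (\<lambda>x. f x - g x)
           = L2_inner f f - 2 * L2_inner f g + L2_inner g g"
proof -
  let ?d = "\<lambda>x. f x - g x"
  have "L2_inner ?d ?d = L2_inner ?d f - L2_inner ?d g"
    using L2_inner_diff_left[OF assms L2_diff[OF assms]]
    by (simp only: L2_inner_commute[of f ?d] L2_inner_commute[of g ?d])
  moreover have "L2_inner ?d f = L2_inner f f - L2_inner f g"
    using L2_inner_diff_left[OF assms assms(1)] by (simp only: L2_inner_commute[of g f])
  moreover have "L2_inner ?d g = L2_inner f g - L2_inner g g"
    by (rule L2_inner_diff_left[OF assms assms(2)])
  ultimately show ?thesis by simp
qed

lemma L2_Cauchy_Schwarz: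
  assumes "f \<in> L2" "g \<in> L2"
  shows "\<bar>L2_inner f g\<bar> \<le> L2_norm f * L2_norm g"
proof -
  define A B C where "A = L2_inner f f" and "B = L2_inner g g" and "C = L2_inner f g"
  have quad: "0 \<le> s\<^sup>2 * A - 2 * (s * t) * C + t\<^sup>2 * B" for s t
  proof -
    have "0 \<le> L2_inner (\<lambda>x. s * f x - t * g x) (\<lambda>x. s * f x - t * g x)"
      by (rule L2_inner_self_nonneg)
    also have "\<dots> = s * (s * A) - 2 * (s * (t * C)) + t * (t * B)"
      unfolding L2_inner_self_diff[OF L2_scale[OF assms(1)] L2_scale[OF assms(2)]]
        L2_inner_scale_left L2_inner_commute[of _ "\<lambda>x. s * f x"]
        L2_inner_commute[of _ "\<lambda>x. t * g x"] A_def B_def C_def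
      by (simp add: L2_inner_scale_left L2_inner_commute[of g f])
    finally show ?thesis by (simp add: power2_eq_square mult_ac)
  qed
  have "C\<^sup>2 \<le> A * B"
  \<comment> \<open>If \<open>B = 0\<close>, the form is linear in \<open>t\<close> and the chosen \<open>t\<close> makes it \<open>-1\<close>; otherwise the
     minimising ratio is \<open>t / s = C / B\<close>.\<close>
  proof (cases "B = 0")
    case True
    have "C = 0"
    proof (rule ccontr)
      assume "C \<noteq> 0"
      then show False using quad[of 1 "(A + 1) / (2 * C)"] True by (simp add: field_simps)
    qed
    then show ?thesis using True by simp
  next
    case False
    then have "B > 0" using L2_inner_self_nonneg[of g] by (simp add: B_def)
    moreover have "0 \<le> B * (A * B - C\<^sup>2)"
      using quad[of B C] by (simp add: power2_eq_square algebra_simps)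
    ultimately show ?thesis by (simp add: zero_le_mult_iff)
  qed
  then have "(L2_inner f g)\<^sup>2 \<le> (L2_norm f * L2_norm g)\<^sup>2"
    by (simp add: A_def B_def C_def power_mult_distrib L2_norm_power2)
  then show ?thesis
    using abs_le_square_iff[of "L2_inner f g" "L2_norm f * L2_norm g"]
    by (simp add: L2_norm_nonneg abs_mult)
qed

text \<open>Best approximation, by Pythagoras. In the application \<open>s\<close> is a Fourier partial sum of
  \<open>g\<close> and \<open>p\<close> a combination of the same basis functions. Asking for orthogonality to \<open>s\<close> and
  \<open>p\<close> rather than to a subspace avoids writing out the coefficients of \<open>p\<close>.\<close>

lemma L2_norm_le_orthogonal:
  assumes "g \<in> L2" "s \<in> L2" "p \<in> L2"
    and "L2_inner (\<lambda>x. g x - s x) s = 0" "L2_inner (\<lambda>x. g x - s x) p = 0"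
  shows "L2_norm (\<lambda>x. g x - s x) \<le> L2_norm (\<lambda>x. g x - p x)"
proof -
  let ?e = "\<lambda>x. g x - s x" and ?d = "\<lambda>x. p x - s x"
  have mem: "?e \<in> L2" "?d \<in> L2" using assms by (auto intro: L2_diff)
  have "L2_inner ?e ?d = 0"
    using L2_inner_diff_left[OF assms(3,2) mem(1)] assms(4,5) by (simp add: L2_inner_commute)
  then have "L2_inner (\<lambda>x. ?e x - ?d x) (\<lambda>x. ?e x - ?d x) = L2_inner ?e ?e + L2_inner ?d ?d"
    using L2_inner_self_diff[OF mem] by simp
  then have "L2_inner ?e ?e \<le> L2_inner (\<lambda>x. g x - p x) (\<lambda>x. g x - p x)"
    using L2_inner_self_nonneg[of ?d] by simp
  then show ?thesis by (simp add: L2_norm_def)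
qed

section \<open>Square-integrability of the logarithm of the tangent\<close>

text \<open>The tangents of \<open>x\<close> and \<open>pi/2 - x\<close> are inverse to each other. With the values \<open>0\<close> of
  \<open>inverse 0\<close> and \<open>ln 0\<close> this includes the singularities.\<close>

lemma ln_tan_reflect: "ln (tan (pi/2 - x)) = - ln (tan (x::real))"
  by (simp add: tan_def sin_diff cos_diff flip: ln_inverse)

text \<open>The zero of \<open>sin (2 x)\<close> beats the logarithmic singularity at both endpoints. The endpoint
  values are right because \<open>sin (2 x)\<close> vanishes there, whatever \<open>ln (tan x)\<close> is. Both the
  integration by parts and the approximation argument reduce their boundary behaviour to this
  function.\<close>

lemma continuous_on_sin_times_ln_tan:
  "continuous_on {0..pi/2} (\<lambda>x::real. sin (2 * x) * ln (tan x))"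
proof -
  let ?f = "\<lambda>x::real. sin (2 * x) * ln (tan x)"
  have lim0: "(?f \<longlongrightarrow> 0) (at_right 0)"
    by real_asymp
  have refl: "?f (pi/2 - x) = - ?f x" for x
    unfolding ln_tan_reflect by (simp add: right_diff_distrib sin_diff)
  have cont: "isCont ?f x" if "0 < x" "x < pi/2" for x
    using that cos_gt_zero[of x] tan_gt_zero[of x]
    by (intro continuous_intros) auto
  have "((\<lambda>x. - ?f (pi/2 - x)) \<longlongrightarrow> - 0) (at_left (pi/2))"
    by (intro tendsto_minus filterlim_compose[OF lim0]) real_asymp
  then have lim1: "(?f \<longlongrightarrow> 0) (at_left (pi/2))"
    unfolding refl by simp
  show ?thesis
    unfolding continuous_on_eq_continuous_within
  proof
    fix x :: real assume "x \<in> {0..pi/2}"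
    then consider "x = 0" | "x = pi/2" | "0 < x" "x < pi/2" by fastforce
    then show "continuous (at x within {0..pi/2}) ?f"
    proof cases
      case 1
      then show ?thesis
        using lim0 pi_gt_zero by (simp add: continuous_within at_within_Icc_at_right)
    next
      case 2
      then show ?thesis
        using lim1 pi_gt_zero unfolding \<open>x = pi/2\<close>
        by (simp add: continuous_within at_within_Icc_at_left)
    next
      case 3
      then show ?thesis using cont continuous_at_imp_continuous_at_within by blast
    qed
  qed
qed

lemma ln_tan_measurable: "(\<lambda>x::real. ln (tan x)) \<in> borel_measurable Leb"
proof -
  have "(\<lambda>x::real. ln (tan x)) \<in> borel_measurable borel"
    unfolding tan_def by measurable
  then show ?thesis
    by (intro measurable_restrict_space1 measurable_completion) simp
qed

text \<open>On \<open>(0, pi/4]\<close> one has \<open>x \<le> tan x \<le> 1\<close>, so the first summand alone suffices; the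
  reflection about \<open>pi/4\<close> exchanges the two summands.\<close>

lemma ln_tan_power2_le:
  fixes x :: real
  assumes "0 < x" "x < pi/2"
  shows "(ln (tan x))\<^sup>2 \<le> (ln x)\<^sup>2 + (ln (pi/2 - x))\<^sup>2"
proof -
  have left: "(ln (tan y))\<^sup>2 \<le> (ln y)\<^sup>2" if "0 < y" "y \<le> pi/4" for y :: real
  proof -
    have "y \<le> tan y"
      using abs_tan_ge[of y] that tan_gt_zero[of y] by simp
    moreover have "tan y \<le> 1"
      using tan_mono_le[of y "pi/4"] that by (simp add: tan_45)
    ultimately have "ln y \<le> ln (tan y)" "ln (tan y) \<le> 0"
      using that by auto
    then show ?thesis using abs_le_square_iff[of "ln (tan y)" "ln y"] by simp
  qed
  show ?thesis
  proof (cases "x \<le> pi/4")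
    case True
    then show ?thesis using left[of x] assms by (simp add: add_increasing2)
  next
    case False
    then have "(ln (tan (pi/2 - x)))\<^sup>2 \<le> (ln (pi/2 - x))\<^sup>2"
      using left[of "pi/2 - x"] assms by simp
    then show ?thesis unfolding ln_tan_reflect by (simp add: add_increasing)
  qed
qed

text \<open>The integrable majorant of \<open>(ln (tan x))\<^sup>2\<close> from the preceding bound.\<close>

lemma ln_power2_integrable: "integrable Leb (\<lambda>x. (ln x)\<^sup>2 + (ln (pi/2 - x))\<^sup>2)"
proof -
  define A :: "real \<Rightarrow> real" where "A x = x * (ln x)\<^sup>2 - 2 * (x * ln x) + 2 * x" for x
  \<comment> \<open>\<open>A\<close> is a primitive of \<open>(ln x)\<^sup>2\<close>. It extends continuously to \<open>0\<close>, so the fundamental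
     theorem of calculus applies although the integrand is unbounded.\<close>
  have contA: "continuous_on {0..pi/2} A"
    unfolding continuous_on_eq_continuous_within
  proof
    fix x :: real assume x: "x \<in> {0..pi/2}"
    show "continuous (at x within {0..pi/2}) A"
    proof (cases "x = 0")
      case True
      have "((\<lambda>x::real. x * (ln x)\<^sup>2 - 2 * (x * ln x) + 2 * x) \<longlongrightarrow> 0) (at_right 0)"
        by real_asymp
      then show ?thesis
        using True pi_gt_zero by (simp add: continuous_within at_within_Icc_at_right A_def[abs_def])
    next
      case False
      then show ?thesis
        unfolding A_def using x by (intro continuous_intros) auto
    qed
  qed
  have derA: "(A has_real_derivative (ln x)\<^sup>2) (at x)" if "0 < x" for x
    unfolding A_def using that
    by (auto intro!: derivative_eq_intros simp: power2_eq_square field_simps)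
  have "((\<lambda>x. (ln x)\<^sup>2 + (ln (pi/2 - x))\<^sup>2) has_integral
          ((A (pi/2) - A (pi/2 - pi/2)) - (A 0 - A (pi/2 - 0)))) {0..pi/2}"
  proof (rule fundamental_theorem_of_calculus_interior)
    show "continuous_on {0..pi/2} (\<lambda>x. A x - A (pi/2 - x))"
      by (intro continuous_intros contA continuous_on_compose2[OF contA]) auto
    fix x :: real assume x: "x \<in> {0<..<pi/2}"
    have "((\<lambda>x. A (pi/2 - x)) has_real_derivative ((ln (pi/2 - x))\<^sup>2 * (0 - 1))) (at x)"
      using x by (intro DERIV_chain2[OF derA] derivative_intros) auto
    then have "((\<lambda>x. A x - A (pi/2 - x)) has_real_derivative
            ((ln x)\<^sup>2 - (ln (pi/2 - x))\<^sup>2 * (0 - 1))) (at x)"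
      using x by (intro DERIV_diff derA) auto
    then show "((\<lambda>x. A x - A (pi/2 - x)) has_vector_derivative
            ((ln x)\<^sup>2 + (ln (pi/2 - x))\<^sup>2)) (at x)"
      by (simp add: has_real_derivative_iff_has_vector_derivative)
  qed simp
  then have "(\<lambda>x. (ln x)\<^sup>2 + (ln (pi/2 - x))\<^sup>2) absolutely_integrable_on {0..pi/2}"
    by (intro nonnegative_absolutely_integrable_1) (auto simp: has_integral_iff)
  then show ?thesis by (intro absolutely_integrable_imp_integrable) auto
qed

lemma AE_Leb_interior: "AE x in Leb. 0 < x \<and> x < pi/2"
proof -
  have "AE x in lebesgue. x \<notin> {0, pi/2 :: real}"
    by (rule AE_not_in) (simp add: negligible_iff_null_sets[symmetric])
  then show ?thesis
    by (subst AE_restrict_space_iff) auto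
qed

lemma ln_tan_L2: "(\<lambda>x. ln (tan x)) \<in> L2"
proof -
  have "integrable Leb (\<lambda>x. (ln (tan x))\<^sup>2)"
  proof (rule Bochner_Integration.integrable_bound[OF ln_power2_integrable])
    show "(\<lambda>x. (ln (tan x))\<^sup>2) \<in> borel_measurable Leb"
      using ln_tan_measurable by measurable
    show "AE x in Leb. norm ((ln (tan x))\<^sup>2) \<le> norm ((ln x)\<^sup>2 + (ln (pi/2 - x))\<^sup>2)"
      using AE_Leb_interior by eventually_elim (use ln_tan_power2_le in auto)
  qed
  then show ?thesis using ln_tan_measurable by (simp add: L2_def)
qed

section \<open>The sine coefficients of the logarithm of the tangent\<close>

text \<open>Telescoping: \<open>sin\<^sup>2 (u + v) - sin\<^sup>2 u = sin v * sin (2 u + v)\<close>, with \<open>v = 2 x\<close>.\<close>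

lemma sin_power2_eq_sum:
  fixes x :: real
  shows "(sin (2 * real n * x))\<^sup>2 = sin (2 * x) * (\<Sum>k=1..n. sin (2 * (2 * real k - 1) * x))"
proof (induction n)
  case (Suc n)
  have "(sin (2 * real (Suc n) * x))\<^sup>2 - (sin (2 * real n * x))\<^sup>2
      = sin (2 * x) * sin (2 * (2 * real (Suc n) - 1) * x)"
  proof -
    define u v where "u = 2 * real n * x" and "v = 2 * x"
    have "2 * real (Suc n) * x = u + v" "2 * (2 * real (Suc n) - 1) * x = u + (u + v)"
      by (simp_all add: u_def v_def algebra_simps)
    moreover have "(sin (u + v))\<^sup>2 - (sin u)\<^sup>2 = sin v * sin (u + (u + v))"
    proof -
      have "sin (u + (u + v)) = sin u * cos (u + v) + cos u * sin (u + v)" by (rule sin_add)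
      moreover have "sin v = sin (u + v) * cos u - cos (u + v) * sin u"
        using sin_diff[of "u + v" u] by simp
      moreover have "(cos u)\<^sup>2 = 1 - (sin u)\<^sup>2" "(cos (u+v))\<^sup>2 = 1 - (sin (u+v))\<^sup>2"
        by (simp_all add: cos_squared_eq)
      ultimately show ?thesis by algebra
    qed
    ultimately show ?thesis by (simp add: u_def v_def)
  qed
  then show ?case using Suc by (simp add: distrib_left)
qed simp

text \<open>\<open>P\<close> below is what integration by parts yields as a primitive. The identity for
  \<open>sin\<^sup>2 (2 n x)\<close> has two uses: it makes the boundary term a multiple of
  \<open>sin (2 x) * ln (tan x)\<close>, so \<open>P\<close> is continuous on the closed interval, and it cancels the
  denominator \<open>sin (2 x)\<close> in the derivative of \<open>ln (tan x)\<close>. At both endpoints the boundary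
  term vanishes and only the cosine sums contribute.\<close>

lemma integral_ln_tan_sin:
  assumes "n \<ge> 1"
  shows "((\<lambda>x. ln (tan x) * sin (4 * real n * x)) has_integral (- (h n / real n))) {0..pi/2}"
proof -
  let ?S = "\<lambda>x. \<Sum>k=1..n. sin (2 * (2 * real k - 1) * x)"
  let ?C = "\<lambda>x. \<Sum>k=1..n. cos (2 * (2 * real k - 1) * x) / (2 * (2 * real k - 1))"
  define P where "P x = (?S x * (sin (2 * x) * ln (tan x)) / 2 + ?C x) / real n" for x
  have n0: "real n \<noteq> 0" using assms by simp
  have P_eq: "P x = ((sin (2 * real n * x))\<^sup>2 * ln (tan x) / 2 + ?C x) / real n" for x
    unfolding P_def sin_power2_eq_sum by (simp add: mult_ac)
  have "((\<lambda>x. ln (tan x) * sin (4 * real n * x)) has_integral (P (pi/2) - P 0)) {0..pi/2}"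
  proof (rule fundamental_theorem_of_calculus_interior)
    show "continuous_on {0..pi/2} P"
      unfolding P_def
      by (intro continuous_intros continuous_on_sin_times_ln_tan) (use n0 in auto)
    fix x :: real assume x: "x \<in> {0<..<pi/2}"
    have pos: "0 < sin x" "0 < cos x"
      using x cos_gt_zero[of x] sin_gt_zero[of x] by auto
    have "0 < tan x" "cos x \<noteq> 0" using pos by (simp_all add: tan_def)
    then have "((\<lambda>x. ln (tan x)) has_real_derivative (1 / tan x * inverse ((cos x)\<^sup>2))) (at x)"
      by (intro DERIV_chain2[OF DERIV_ln_divide DERIV_tan])
    also have "1 / tan x * inverse ((cos x)\<^sup>2) = 2 / sin (2 * x)"
      using pos by (simp add: tan_def sin_double power2_eq_square inverse_eq_divide)
    finally have d1: "((\<lambda>x. ln (tan x)) has_real_derivative (2 / sin (2 * x))) (at x)" .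
    have d2: "((\<lambda>x. (sin (2 * real n * x))\<^sup>2) has_real_derivative
        (2 * real n * sin (4 * real n * x))) (at x)"
      using sin_double[of "2 * real n * x"]
      by (auto intro!: derivative_eq_intros simp: mult_ac)
    have d3: "(?C has_real_derivative - ?S x) (at x)"
    proof -
      have "(?C has_real_derivative (\<Sum>k=1..n. - sin (2 * (2 * real k - 1) * x))) (at x)"
      proof (intro DERIV_sum)
        fix k assume "k \<in> {1..n}"
        then have "2 * (2 * real k - 1) \<noteq> 0" by auto
        moreover have "((\<lambda>x. cos (c * x) / c) has_real_derivative - sin (c * x)) (at x)"
          if "c \<noteq> 0" for c :: real
          using that by (auto intro!: derivative_eq_intros simp: field_simps)
        ultimately show "((\<lambda>x. cos (2 * (2 * real k - 1) * x) / (2 * (2 * real k - 1)))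
            has_real_derivative - sin (2 * (2 * real k - 1) * x)) (at x)" by blast
      qed
      then show ?thesis by (simp add: sum_negf)
    qed
    have "(P has_real_derivative
      (((2 * real n * sin (4 * real n * x)) * ln (tan x)
         + (2 / sin (2 * x)) * (sin (2 * real n * x))\<^sup>2) / 2 + - ?S x) / real n) (at x)"
      unfolding P_eq by (intro DERIV_cdivide DERIV_add DERIV_mult d1 d2 d3)
    also have "(2 / sin (2 * x)) * (sin (2 * real n * x))\<^sup>2 = 2 * ?S x"
      unfolding sin_power2_eq_sum using pos by (simp add: sin_double)
    also have "((2 * real n * sin (4 * real n * x)) * ln (tan x) + 2 * ?S x) / 2 + - ?S x
        = real n * (ln (tan x) * sin (4 * real n * x))"
      by (simp add: add_divide_distrib)
    finally show "(P has_vector_derivative ln (tan x) * sin (4 * real n * x)) (at x)"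
      using n0 by (simp add: has_real_derivative_iff_has_vector_derivative[symmetric])
  qed simp
  also have "P (pi/2) - P 0 = - (h n / real n)"
  proof -
    have "?C (pi/2) = - ?C 0"
    proof (subst sum_negf[symmetric], rule sum.cong)
      fix k assume "k \<in> {1..n}"
      have "cos (2 * (2 * real k - 1) * (pi/2)) = cos (2 * real k * pi - pi)"
        by (simp add: algebra_simps)
      also have "\<dots> = -1" by (simp add: cos_diff)
      finally show "cos (2 * (2 * real k - 1) * (pi/2)) / (2 * (2 * real k - 1))
          = - (cos (2 * (2 * real k - 1) * 0) / (2 * (2 * real k - 1)))" by simp
    qed simp
    moreover have "?C 0 = h n / 2"
      by (simp add: h_def sum_divide_distrib)
    ultimately show ?thesis by (simp add: P_def field_simps)
  qed
  finally show ?thesis .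
qed

lemma sin_L2: "(\<lambda>x. sin (c * x)) \<in> L2"
  by (intro L2_continuous continuous_intros)

lemma L2_inner_eqI:
  assumes "f \<in> L2" "g \<in> L2" "((\<lambda>x. f x * g x) has_integral i) {0..pi/2}"
  shows "L2_inner f g = 4 / pi * i"
  using lebesgue_integral_eq_integral[OF L2_mult_integrable[OF assms(1,2)]] assms(3)
  by (simp add: L2_inner_def integral_unique)

lemma L2_inner_ln_tan_sin:
  "L2_inner (\<lambda>x. ln (tan x)) (\<lambda>x. sin (4 * real (Suc n) * x))
     = - (4 / pi) * (h (Suc n) / real (Suc n))"
  using L2_inner_eqI[OF ln_tan_L2 sin_L2 integral_ln_tan_sin[of "Suc n"]] by simp

lemma L2_inner_sin_sin:
  "L2_inner (\<lambda>x. sin (4 * real (Suc m) * x)) (\<lambda>x. sin (4 * real (Suc n) * x))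
     = (if m = n then 1 else 0)"
proof -
  have cosint: "((\<lambda>x. cos (4 * c * x)) has_integral (if c = 0 then pi/2 else 0)) {0..pi/2}"
    if "c \<in> \<int>" for c :: real
  proof (cases "c = 0")
    case True
    then show ?thesis using has_integral_const_real[of "1::real" 0 "pi/2"] by simp
  next
    case False
    have "((\<lambda>x. cos (4 * c * x)) has_integral
        (sin (4 * c * (pi/2)) / (4 * c) - sin (4 * c * 0) / (4 * c))) {0..pi/2}"
      by (rule fundamental_theorem_of_calculus)
        (use False in \<open>auto intro!: derivative_eq_intros
          simp: has_real_derivative_iff_has_vector_derivative[symmetric]\<close>)
    moreover have "sin (4 * c * (pi/2)) = 0"
      using sin_integer_2pi[OF that] by (simp add: mult_ac)
    ultimately show ?thesis using False by simp
  qed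
  have "((\<lambda>x. (cos (4 * (real m - real n) * x) - cos (4 * (real m + real n + 2) * x)) / 2)
      has_integral (((if real m - real n = 0 then pi/2 else 0)
        - (if real m + real n + 2 = 0 then pi/2 else 0)) / 2)) {0..pi/2}"
    by (intro has_integral_divide has_integral_diff cosint) auto
  moreover have "(cos (4 * (real m - real n) * x) - cos (4 * (real m + real n + 2) * x)) / 2
      = sin (4 * real (Suc m) * x) * sin (4 * real (Suc n) * x)" for x
    unfolding sin_times_sin by (simp add: algebra_simps)
  moreover have "((if real m - real n = 0 then pi/2 else 0)
      - (if real m + real n + 2 = 0 then pi/2 else 0)) / 2 = (if m = n then pi/4 else 0)"
    by (simp add: add_nonneg_eq_0_iff)
  ultimately have "((\<lambda>x. sin (4 * real (Suc m) * x) * sin (4 * real (Suc n) * x))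
      has_integral (if m = n then pi/4 else 0)) {0..pi/2}"
    by (simp only:)
  from L2_inner_eqI[OF sin_L2 sin_L2 this] show ?thesis by simp
qed

section \<open>Approximation by sine polynomials\<close>

text \<open>The linear span of the functions \<open>sin (4 n x)\<close>, \<open>n \<ge> 1\<close>. Generating it one term at a time
  lets linearity arguments run by induction, without handling coefficient vectors.\<close>

inductive_set sine_polys :: "(real \<Rightarrow> real) set" where
  zero: "(\<lambda>x. 0) \<in> sine_polys"
| add_sin: "p \<in> sine_polys \<Longrightarrow> (\<lambda>x. p x + c * sin (4 * real (Suc n) * x)) \<in> sine_polys"

lemma sine_polys_add:
  assumes "q \<in> sine_polys" "p \<in> sine_polys"
  shows "(\<lambda>x. p x + q x) \<in> sine_polys"
  using assms(1)
proof induction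
  case zero
  then show ?case using assms(2) by simp
next
  case (add_sin q c n)
  then show ?case using sine_polys.add_sin[of "\<lambda>x. p x + q x" c n] by (simp add: add.assoc)
qed

lemma sine_polys_scale:
  assumes "p \<in> sine_polys"
  shows "(\<lambda>x. d * p x) \<in> sine_polys"
  using assms
proof induction
  case zero
  then show ?case using sine_polys.zero by simp
next
  case (add_sin q c n)
  then show ?case
    using sine_polys.add_sin[of "\<lambda>x. d * q x" "d * c" n] by (simp add: distrib_left mult.assoc)
qed

text \<open>\<open>sin (4 n x) * cos (4 x)\<close> is half the sum of \<open>sin (4 (n + 1) x)\<close> and
  \<open>sin (4 (n - 1) x)\<close>, and the latter is zero when \<open>n = 1\<close>, so the span is not left at its lower end.\<close>

lemma sine_polys_times_cos:
  assumes "p \<in> sine_polys"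
  shows "(\<lambda>x. cos (4 * x) * p x) \<in> sine_polys"
  using assms
proof induction
  case zero
  then show ?case using sine_polys.zero by simp
next
  case (add_sin q c n)
  have eq: "cos (4 * x) * (q x + c * sin (4 * real (Suc n) * x))
      = (cos (4 * x) * q x + c/2 * sin (4 * real (Suc (Suc n)) * x)) + c/2 * sin (4 * real n * x)"
    for x
  proof -
    have "sin (4 * real (Suc n) * x) * cos (4 * x)
        = (sin (4 * real (Suc (Suc n)) * x) + sin (4 * real n * x)) / 2"
      unfolding sin_times_cos by (simp add: algebra_simps)
    then have "c * (sin (4 * real (Suc n) * x) * cos (4 * x))
        = c/2 * sin (4 * real (Suc (Suc n)) * x) + c/2 * sin (4 * real n * x)"
      by (simp add: distrib_left add_divide_distrib del: of_nat_Suc)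
    then show ?thesis by (simp add: distrib_left mult_ac del: of_nat_Suc)
  qed
  have *: "(\<lambda>x. cos (4 * x) * q x + c/2 * sin (4 * real (Suc (Suc n)) * x)) \<in> sine_polys"
    by (rule sine_polys.add_sin[OF add_sin.IH])
  show ?case
  proof (cases n)
    case 0
    then show ?thesis unfolding eq using * by simp
  next
    case (Suc k)
    then show ?thesis unfolding eq using sine_polys.add_sin[OF *, of "c/2" k] by simp
  qed
qed

lemma sin_times_polynomial_cos:
  assumes "real_polynomial_function (P :: real \<Rightarrow> real)"
  shows "(\<lambda>x. sin (4 * x) * P (cos (4 * x))) \<in> sine_polys"
proof -
  obtain a n where P: "P = (\<lambda>y. \<Sum>i\<le>n. a i * y ^ i)"
    using assms unfolding real_polynomial_function_iff_sum by blast
  have power: "(\<lambda>x. cos (4 * x) ^ i * sin (4 * x)) \<in> sine_polys" for i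
  proof (induction i)
    case 0
    then show ?case using sine_polys.add_sin[OF sine_polys.zero, of 1 0] by simp
  next
    case (Suc i)
    then show ?case using sine_polys_times_cos[OF Suc] by (simp add: mult.assoc)
  qed
  have "(\<lambda>x. \<Sum>i\<le>m. a i * (cos (4 * x) ^ i * sin (4 * x))) \<in> sine_polys" for m
  proof (induction m)
    case 0
    then show ?case using sine_polys_scale[OF power[of 0]] by simp
  next
    case (Suc m)
    show ?case
      using sine_polys_add[OF sine_polys_scale[OF power[of "Suc m"], of "a (Suc m)"] Suc]
      by simp
  qed
  then show ?thesis by (simp add: P sum_distrib_left mult_ac)
qed

lemma sine_polys_continuous:
  assumes "p \<in> sine_polys"
  shows "continuous_on S p"
  using assms by induction (auto intro!: continuous_intros)

lemma sine_polys_L2: "p \<in> sine_polys \<Longrightarrow> p \<in> L2"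
  by (intro L2_continuous sine_polys_continuous)

text \<open>\<open>cos (4 x)\<close> maps \<open>[0, pi/4]\<close> bijectively onto \<open>[-1, 1]\<close> and identifies \<open>x\<close> with
  \<open>pi/2 - x\<close>. A symmetric continuous \<open>F\<close> is therefore a continuous function of \<open>cos (4 x)\<close>, to
  which the Weierstrass approximation theorem applies.\<close>

lemma uniform_approx_sine_polys:
  assumes cont: "continuous_on {0..pi/2} F"
    and symm: "\<And>x. F (pi/2 - x) = F x" and "0 < e"
  obtains p where "p \<in> sine_polys"
    "\<And>x. x \<in> {0..pi/2} \<Longrightarrow> \<bar>sin (4 * x) * F x - p x\<bar> < e"
proof -
  define G where "G y = F (arccos y / 4)" for y
  have "continuous_on {-1..1} G"
    unfolding G_def
    by (intro continuous_on_compose2[OF cont] continuous_intros)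
      (use arccos_lbound arccos_ubound in \<open>fastforce+\<close>)
  then obtain P where P: "real_polynomial_function P"
      "\<And>y. y \<in> {-1..1} \<Longrightarrow> \<bar>G y - P y\<bar> < e"
    using Stone_Weierstrass_real_polynomial_function[of "{-1..1::real}" G e] \<open>0 < e\<close> by auto
  have G_cos: "G (cos (4 * x)) = F x" if "x \<in> {0..pi/2}" for x
  proof (cases "x \<le> pi/4")
    case True
    then show ?thesis using that by (simp add: G_def arccos_cos)
  next
    case False
    have "cos (4 * x) = cos (4 * (pi/2 - x))"
      by (simp add: right_diff_distrib cos_diff)
    moreover have "arccos (cos (4 * (pi/2 - x))) = 4 * (pi/2 - x)"
      using False that by (intro arccos_cos) auto
    ultimately have "arccos (cos (4 * x)) = 4 * (pi/2 - x)" by simp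
    then show ?thesis using symm[of x] by (simp add: G_def diff_divide_distrib)
  qed
  show thesis
  proof (rule that[OF sin_times_polynomial_cos[OF P(1)]])
    fix x :: real assume x: "x \<in> {0..pi/2}"
    have "\<bar>sin (4 * x) * F x - sin (4 * x) * P (cos (4 * x))\<bar>
        = \<bar>sin (4 * x)\<bar> * \<bar>G (cos (4 * x)) - P (cos (4 * x))\<bar>"
      by (simp add: G_cos[OF x] flip: abs_mult right_diff_distrib)
    also have "\<dots> \<le> 1 * \<bar>G (cos (4 * x)) - P (cos (4 * x))\<bar>"
      by (intro mult_right_mono) auto
    also have "\<dots> < e" using P(2)[of "cos (4 * x)"] by simp
    finally show "\<bar>sin (4 * x) * F x - sin (4 * x) * P (cos (4 * x))\<bar> < e" .
  qed
qed

text \<open>The damping factor \<open>s\<^sup>2 / (s\<^sup>2 + 1/(m+1))\<close>, \<open>s = sin (4 x)\<close>, lies in \<open>[0, 1]\<close> and tends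
  to \<open>1\<close> wherever \<open>s \<noteq> 0\<close>, that is, off \<open>0\<close>, \<open>pi/4\<close> and \<open>pi/2\<close>.\<close>

lemma damped_ln_tan_limit:
  "(\<lambda>m. \<integral>x. (ln (tan x) - ln (tan x) * (sin (4 * x))\<^sup>2 / ((sin (4 * x))\<^sup>2 + 1 / real (Suc m)))\<^sup>2 \<partial>Leb)
     \<longlonglongrightarrow> 0"
proof -
  let ?g = "\<lambda>x::real. ln (tan x)" and ?s = "\<lambda>x::real. (sin (4 * x))\<^sup>2"
  let ?d = "\<lambda>m x. (?g x - ?g x * ?s x / (?s x + 1 / real (Suc m)))\<^sup>2"
  have "(\<lambda>m. \<integral>x. ?d m x \<partial>Leb) \<longlonglongrightarrow> (\<integral>x. 0 \<partial>Leb)"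
  proof (rule integral_dominated_convergence[where w = "\<lambda>x. (?g x)\<^sup>2"])
    show "integrable Leb (\<lambda>x. (?g x)\<^sup>2)" using ln_tan_L2 by (simp add: L2_def)
    have [measurable]: "?s \<in> borel_measurable Leb"
      by (intro continuous_imp_measurable_on_sets_lebesgue continuous_intros) auto
    note ln_tan_measurable[measurable]
    show "?d m \<in> borel_measurable Leb" for m by measurable
    have "AE x in lebesgue. x \<noteq> pi/4"
      using AE_not_in[of "{pi/4::real}" lebesgue] by (simp add: negligible_iff_null_sets[symmetric])
    then have "AE x in Leb. x \<noteq> pi/4"
      by (subst AE_restrict_space_iff) auto
    with AE_Leb_interior show "AE x in Leb. (\<lambda>m. ?d m x) \<longlonglongrightarrow> 0"
    proof eventually_elim
      case (elim x)
      have "sin (4 * x) \<noteq> 0"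
      proof (cases "x < pi/4")
        case True
        then show ?thesis using elim sin_gt_zero[of "4 * x"] by simp
      next
        case False
        then show ?thesis using elim sin_lt_zero[of "4 * x"] by simp
      qed
      then have s: "?s x \<noteq> 0" by simp
      have "(\<lambda>m. 1 / real (Suc m)) \<longlonglongrightarrow> 0" by (rule LIMSEQ_Suc[OF lim_1_over_n])
      then have "(\<lambda>m. ?d m x) \<longlonglongrightarrow> (?g x - ?g x * ?s x / (?s x + 0))\<^sup>2"
        using s by (intro tendsto_intros) auto
      then show ?case using s by simp
    qed
    show "AE x in Leb. norm (?d m x) \<le> (?g x)\<^sup>2" for m
    proof (rule AE_I2)
      fix x
      define e where "e = 1 / real (Suc m)"
      have e: "e > 0" by (simp add: e_def)
      have "0 < ?s x + e" using e by (simp add: add_nonneg_pos)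
      then have "?g x - ?g x * ?s x / (?s x + e) = ?g x * (e / (?s x + e))"
        by (simp add: field_simps)
      moreover have "\<bar>e / (?s x + e)\<bar> \<le> 1"
        using e \<open>0 < ?s x + e\<close> by (simp add: abs_of_pos)
      ultimately have "\<bar>?g x - ?g x * ?s x / (?s x + e)\<bar> \<le> \<bar>?g x\<bar>"
        using mult_left_le[of "\<bar>e / (?s x + e)\<bar>" "\<bar>?g x\<bar>"] by (simp only: abs_mult abs_ge_zero)
      then show "norm (?d m x) \<le> (?g x)\<^sup>2"
        unfolding e_def[symmetric] by (simp add: abs_le_square_iff)
    qed
  qed auto
  then show ?thesis by simp
qed

text \<open>The damped function is \<open>sin (4 x) * F x\<close>, where \<open>F\<close> has numerator
  \<open>sin (4 x) * ln (tan x)\<close>: continuous up to the endpoints, and symmetric about \<open>pi/4\<close> as a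
  product of two antisymmetric factors.\<close>

lemma ln_tan_approx_sine_polys:
  assumes "0 < e"
  obtains p where "p \<in> sine_polys" "L2_norm (\<lambda>x. ln (tan x) - p x) < e"
proof -
  let ?g = "\<lambda>x::real. ln (tan x)" and ?s = "\<lambda>x::real. (sin (4 * x))\<^sup>2"
  define k where "k m x = ?g x * ?s x / (?s x + 1 / real (Suc m))" for m x
  \<comment> \<open>The squared \<open>L2_norm\<close> is \<open>4/pi\<close> times an integral over an interval of length \<open>pi/2\<close>, and
     \<open>(a + c)\<^sup>2 \<le> 2 a\<^sup>2 + 2 c\<^sup>2\<close>. The damping error thus contributes less than \<open>e\<^sup>2 / 2\<close>
     and the uniform error \<open>e / 4\<close> at most \<open>e\<^sup>2 / 4\<close>.\<close>
  have "0 < e\<^sup>2 * pi / 16" using assms by simp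
  then obtain m where m: "(\<integral>x. (?g x - k m x)\<^sup>2 \<partial>Leb) < e\<^sup>2 * pi / 16"
    using order_tendstoD(2)[OF damped_ln_tan_limit] unfolding k_def eventually_sequentially
    by blast
  define F where "F x = 2 * cos (2 * x) * (sin (2 * x) * ?g x) / (?s x + 1 / real (Suc m))" for x
  have pos: "0 < ?s x + 1 / real (Suc m)" for x by (simp add: add_nonneg_pos)
  have k_eq: "k m x = sin (4 * x) * F x" for x
    using sin_double[of "2 * x"] by (simp add: k_def F_def power2_eq_square)
  have contF: "continuous_on {0..pi/2} F"
    unfolding F_def
    by (intro continuous_intros continuous_on_sin_times_ln_tan)
      (use pos in \<open>simp add: less_imp_neq[symmetric]\<close>)
  have symF: "F (pi/2 - x) = F x" for x
    unfolding F_def ln_tan_reflect by (simp add: right_diff_distrib sin_diff cos_diff)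
  have "0 < e / 4" using assms by simp
  then obtain p where p: "p \<in> sine_polys"
      "\<And>x. x \<in> {0..pi/2} \<Longrightarrow> \<bar>sin (4 * x) * F x - p x\<bar> < e / 4"
    using uniform_approx_sine_polys[OF contF symF] by blast
  have kL2: "k m \<in> L2"
    unfolding k_eq by (intro L2_continuous continuous_intros contF)
  have int1: "integrable Leb (\<lambda>x. (?g x - k m x)\<^sup>2)"
    using L2_diff[OF ln_tan_L2 kL2] by (simp add: L2_def)
  have "(\<integral>x. (?g x - p x)\<^sup>2 \<partial>Leb) \<le> (\<integral>x. 2 * (?g x - k m x)\<^sup>2 + 2 * (e/4)\<^sup>2 \<partial>Leb)"
  proof (rule integral_mono)
    show "integrable Leb (\<lambda>x. (?g x - p x)\<^sup>2)"
      using L2_diff[OF ln_tan_L2 sine_polys_L2[OF p(1)]] by (simp add: L2_def)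
    show "integrable Leb (\<lambda>x. 2 * (?g x - k m x)\<^sup>2 + 2 * (e/4)\<^sup>2)"
      using int1 continuous_imp_integrable_real[of 0 "pi/2" "\<lambda>x. 2 * (e/4)\<^sup>2"] by auto
    fix x assume "x \<in> space Leb"
    then have "\<bar>k m x - p x\<bar> < e/4" using p(2) k_eq by simp
    then have "(k m x - p x)\<^sup>2 \<le> (e/4)\<^sup>2"
      using abs_le_square_iff[of "k m x - p x" "e/4"] assms by simp
    moreover have "(a + c)\<^sup>2 \<le> 2 * a\<^sup>2 + 2 * c\<^sup>2" for a c :: real
      using zero_le_power2[of "a - c"] by (simp add: power2_eq_square algebra_simps)
    from this[of "?g x - k m x" "k m x - p x"]
    have "(?g x - p x)\<^sup>2 \<le> 2 * (?g x - k m x)\<^sup>2 + 2 * (k m x - p x)\<^sup>2" by simp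
    ultimately show "(?g x - p x)\<^sup>2 \<le> 2 * (?g x - k m x)\<^sup>2 + 2 * (e/4)\<^sup>2" by linarith
  qed
  also have "\<dots> = 2 * (\<integral>x. (?g x - k m x)\<^sup>2 \<partial>Leb) + pi * (e/4)\<^sup>2"
    using int1 continuous_imp_integrable_real[of 0 "pi/2" "\<lambda>x. 2 * (e/4)\<^sup>2"]
      lebesgue_integral_eq_integral[OF continuous_imp_integrable_real[of 0 "pi/2" "\<lambda>x. 2 * (e/4)\<^sup>2"]]
    by simp
  also have "\<dots> < pi / 4 * e\<^sup>2"
  proof -
    have "pi * (e/4)\<^sup>2 = e\<^sup>2 * pi / 16" "pi / 4 * e\<^sup>2 = e\<^sup>2 * pi / 4"
      by (simp_all add: power_divide)
    then show ?thesis using m \<open>0 < e\<^sup>2 * pi / 16\<close> by linarith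
  qed
  finally have "L2_inner (\<lambda>x. ?g x - p x) (\<lambda>x. ?g x - p x) < e\<^sup>2"
    by (simp add: L2_inner_def power2_eq_square field_simps)
  then have "L2_norm (\<lambda>x. ?g x - p x) < e"
    using assms by (simp add: L2_norm_def real_less_lsqrt)
  with p(1) show thesis by (rule that)
qed

section \<open>Convergence of the sine series\<close>

theorem theorem2p2:
  shows "L2_sums (\<lambda>n x. - (4 / pi) * (h (Suc n) / real (Suc n) * sin (4 * real (Suc n) * x)))
           (\<lambda>x. ln (tan x)) \<and>
         (\<forall>f \<in> H_odd.
           summable (\<lambda>n. b (Suc n) f * (h (Suc n) / real (Suc n))) \<and>
           L f = - (\<Sum>n. b (Suc n) f * (h (Suc n) / real (Suc n))))"
proof -
  let ?g = "\<lambda>x::real. ln (tan x)"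
  let ?e = "\<lambda>n x. sin (4 * real (Suc n) * x)"
  define c where "c n = - (4 / pi) * (h (Suc n) / real (Suc n))" for n
  define F where "F n x = c n * ?e n x" for n x
  define S where "S N x = (\<Sum>n<N. F n x)" for N x
  have F_L2: "F n \<in> L2" for n
    unfolding F_def by (intro L2_scale sin_L2)
  have S_L2: "S N \<in> L2" for N
    unfolding S_def by (intro L2_sum F_L2)
  have orth: "L2_inner (\<lambda>x. ?g x - S N x) (?e m) = 0" if "m < N" for m N
  proof -
    have "L2_inner (S N) (?e m) = (\<Sum>n<N. L2_inner (F n) (?e m))"
      unfolding S_def by (intro L2_inner_sum_left F_L2 sin_L2)
    also have "\<dots> = (\<Sum>n<N. if n = m then c n else 0)"
      unfolding F_def L2_inner_scale_left L2_inner_sin_sin by (intro sum.cong) auto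
    also have "\<dots> = c m" using that by simp
    finally show ?thesis
      unfolding L2_inner_diff_left[OF ln_tan_L2 S_L2 sin_L2] L2_inner_ln_tan_sin
      by (simp add: c_def)
  qed
  have orth_S: "L2_inner (\<lambda>x. ?g x - S N x) (S N) = 0" for N
  proof -
    have "L2_inner (S N) (\<lambda>x. ?g x - S N x) = (\<Sum>n<N. L2_inner (F n) (\<lambda>x. ?g x - S N x))"
      unfolding S_def[of N, abs_def]
      by (intro L2_inner_sum_left F_L2 L2_diff ln_tan_L2 L2_sum)
    also have "\<dots> = 0"
      unfolding F_def L2_inner_scale_left L2_inner_commute[of "?e _"]
      using orth by (intro sum.neutral) auto
    finally show ?thesis by (simp add: L2_inner_commute)
  qed
  \<comment> \<open>A sine polynomial involves finitely many frequencies, all of them present in \<open>S N\<close> once \<open>N\<close>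
     is large.\<close>
  have orth_p: "\<exists>N0. \<forall>N\<ge>N0. L2_inner (\<lambda>x. ?g x - S N x) p = 0" if "p \<in> sine_polys" for p
    using that
  proof induction
    case zero
    show ?case by (simp add: L2_inner_def)
  next
    case (add_sin p d n)
    then obtain N0 where N0: "\<And>N. N \<ge> N0 \<Longrightarrow> L2_inner (\<lambda>x. ?g x - S N x) p = 0" by blast
    have "L2_inner (\<lambda>x. ?g x - S N x) (\<lambda>x. p x + d * ?e n x) = 0" if "N \<ge> max N0 (Suc n)" for N
    proof -
      have "L2_inner (\<lambda>x. p x + d * ?e n x) (\<lambda>x. ?g x - S N x) =
          L2_inner p (\<lambda>x. ?g x - S N x) + d * L2_inner (?e n) (\<lambda>x. ?g x - S N x)"
        using L2_inner_add_left[OF sine_polys_L2[OF add_sin.hyps] L2_scale[OF sin_L2]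
            L2_diff[OF ln_tan_L2 S_L2]]
        by (simp only: L2_inner_scale_left)
      then show ?thesis
        using N0[of N] orth[of n N] that by (simp add: L2_inner_commute del: of_nat_Suc)
    qed
    then show ?case by blast
  qed
  have lim: "(\<lambda>N. L2_norm (\<lambda>x. ?g x - S N x)) \<longlonglongrightarrow> 0"
  proof (rule LIMSEQ_I)
    fix r :: real assume "0 < r"
    then obtain p where p: "p \<in> sine_polys" "L2_norm (\<lambda>x. ?g x - p x) < r"
      by (rule ln_tan_approx_sine_polys)
    obtain N0 where N0: "\<And>N. N \<ge> N0 \<Longrightarrow> L2_inner (\<lambda>x. ?g x - S N x) p = 0"
      using orth_p[OF p(1)] by blast
    have "norm (L2_norm (\<lambda>x. ?g x - S N x) - 0) < r" if "N \<ge> N0" for N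
      using L2_norm_le_orthogonal[OF ln_tan_L2 S_L2 sine_polys_L2[OF p(1)] orth_S N0[OF that]]
        p(2) L2_norm_nonneg[of "\<lambda>x. ?g x - S N x"] by simp
    then show "\<exists>N0. \<forall>N\<ge>N0. norm (L2_norm (\<lambda>x. ?g x - S N x) - 0) < r" by blast
  qed
  have "L2_sums F ?g"
    unfolding L2_sums_def using F_L2 ln_tan_L2 lim by (simp add: S_def)
  moreover have "(\<lambda>n. b (Suc n) f * (h (Suc n) / real (Suc n))) sums (- L f)" if "f \<in> H_odd" for f
  proof -
    have f: "f \<in> L2" using that by (simp add: H_odd_def)
    have "(\<lambda>N. L2_inner (\<lambda>x. ?g x - S N x) f) \<longlonglongrightarrow> 0"
    proof (rule Lim_null_comparison)
      show "(\<lambda>N. L2_norm (\<lambda>x. ?g x - S N x) * L2_norm f) \<longlonglongrightarrow> 0"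
        by (rule tendsto_mult_left_zero[OF lim])
      show "\<forall>\<^sub>F N in sequentially. norm (L2_inner (\<lambda>x. ?g x - S N x) f)
          \<le> L2_norm (\<lambda>x. ?g x - S N x) * L2_norm f"
        using L2_Cauchy_Schwarz[OF L2_diff[OF ln_tan_L2 S_L2] f] by simp
    qed
    moreover have "L2_inner (\<lambda>x. ?g x - S N x) f
        = 4 / pi * (L f + (\<Sum>n<N. b (Suc n) f * (h (Suc n) / real (Suc n))))" for N
    proof -
      have "L2_inner (S N) f = (\<Sum>n<N. L2_inner (F n) f)"
        unfolding S_def by (intro L2_inner_sum_left F_L2 f)
      also have "\<dots> = (\<Sum>n<N. c n * b (Suc n) f)"
        unfolding F_def L2_inner_scale_left b_def by (simp add: L2_inner_commute)
      also have "\<dots> = - (4 / pi) * (\<Sum>n<N. b (Suc n) f * (h (Suc n) / real (Suc n)))"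
        unfolding c_def sum_distrib_left by (simp add: mult_ac)
      finally show ?thesis
        unfolding L2_inner_diff_left[OF ln_tan_L2 S_L2 f]
        by (simp add: L2_inner_def L_def mult.commute distrib_left)
    qed
    ultimately have "(\<lambda>N. 4 / pi * (L f + (\<Sum>n<N. b (Suc n) f * (h (Suc n) / real (Suc n)))))
        \<longlonglongrightarrow> 0"
      by simp
    then have "(\<lambda>N. pi / 4 * (4 / pi * (L f + (\<Sum>n<N. b (Suc n) f * (h (Suc n) / real (Suc n)))))
        - L f) \<longlonglongrightarrow> pi / 4 * 0 - L f"
      by (intro tendsto_intros)
    moreover have "pi / 4 * (4 / pi * (L f + s)) - L f = s" for s
      using pi_gt_zero by (simp only: mult.assoc[symmetric]) simp
    ultimately show ?thesis by (simp only: sums_def mult_zero_right diff_0)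
  qed
  ultimately show ?thesis
    unfolding F_def[abs_def] c_def mult.assoc by (auto simp: sums_iff)
qed

end
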